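(* Let $d\ge2$. The linear map $\rho_d:\mathrm{Ker}(\varepsilon_{2,d})\longrightarrow\mathrm{Sym}^{d-2}(E^\sharp)$ defined on the basis $(\boldsymbol{a}_{i-1}\star\boldsymbol{a}_{j+1}-\boldsymbol{a}_i\star\boldsymbol{a}_j)_{1\le i\le j\le d-1}$ of $\mathrm{Ker}(\varepsilon_{2,d})$ by $$\rho_d(\boldsymbol{a}_{i-1}\star\boldsymbol{a}_{j+1}-\boldsymbol{a}_i\star\boldsymbol{a}_j)=q^{\star (d-j-1)}\star Q^{\star (i-1)}\star\Psi^\star_{j-i}(\boldsymbol{eu},q,Q)$$ is an isomorphism of $\mathrm{SL}_2(\mathbb{C})$-modules.
   Context: Let $V_2=\mathbb{C}^2$ be the standard representation of $\mathrm{SL}_2(\mathbb{C})$ with canonical basis $(t,u)$. Let $E^\sharp$ be the $3$-dimensional vector space with basis $(Q,\boldsymbol{eu},q)$ and $E_d$ the $(d+1)$-dimensional vector space with basis $(\boldsymbol{a}_0,\dots,\boldsymbol{a}_d)$. (In the paper these are $\mathrm{SL}_2(\mathbb{C})$-stable subspaces of the center of a rational Cherednik algebra.) They are identified as $\mathrm{SL}_2(\mathbb{C})$-modules with $\mathrm{Sym}^2(V_2)$ and $\mathrm{Sym}^d(V_2)$ respectively, via $$t^2\leftrightarrow 2q,\quad tu\leftrightarrow\boldsymbol{eu},\quad u^2\leftrightarrow 2Q,\qquad t^{d-i}u^i\leftrightarrow\boldsymbol{a}_i\ (0\le i\le d).$$ The symbol $\star$ denotes multiplication in the symmetric algebra $\mathrm{Sym}(E^\sharp\oplus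 E_d)$ (to distinguish it from multiplication in $\mathrm{Sym}(V_2)$ or in the Cherednik algebra); $v^{\star n}$ denotes the $n$-th power, and $\Psi^\star(e_1,\dots,e_n)$ the evaluation of a polynomial $\Psi$ in this symmetric algebra. The map $\varepsilon_{2,d}:\mathrm{Sym}^2(\mathrm{Sym}^d(V_2))\to\mathrm{Sym}^{2d}(V_2)$, $v_1\star v_2\mapsto v_1v_2$, is the $\mathrm{SL}_2(\mathbb{C})$-equivariant evaluation map, and $\mathrm{Sym}^2(\mathrm{Sym}^d(V_2))=\mathrm{Sym}^2(E_d)$. The polynomials $\Psi_i\in\mathbb{C}[T,T',T'']$ ($i\ge0$) are defined by $\Psi_0=1$, $\Psi_1=T$, $\Psi_{i+1}=T\Psi_i-T'T''\Psi_{i-1}$ for $i\ge1$; equivalently $\Psi_i(xX+yY,xy,XY)=\sum_{j=0}^i(xX)^{i-j}(yY)^j$ in $\mathbb{C}[x,y,X,Y]$. The elements $\boldsymbol{a}_{i-1}\star\boldsymbol{a}_{j+1}-\boldsymbol{a}_i\star\boldsymbol{a}_j$, $1\le i\le j\le d-1$, form a basis of $\mathrm{Ker}(\varepsilon_{2,d})$, and the elements $q^{\star(d-j-1)}\star Q^{\star(i-1)}\star\Psi_{j-i}^\star(\boldsymbol{eu},q,Q)$, $1\le i\le j\le d-1$, form a basis of $\mathrm{Sym}^{d-2}(E^\sharp)$. *)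

theory Defs
  imports "HOL-Analysis.Analysis" "HOL-Library.Poly_Mapping"
begin

text \<open>The symmetric algebra of the complex vector space with basis indexed by \<open>'x\<close>: a monomial is
  its exponent function, and an element maps each monomial to its coefficient. The product of this
  ring is the convolution product of \<open>Poly_Mapping\<close>.\<close>

type_synonym 'x sym_alg = "('x \<Rightarrow>\<^sub>0 nat) \<Rightarrow>\<^sub>0 complex"

definition Const :: "complex \<Rightarrow> 'x sym_alg" where
  "Const c = Poly_Mapping.single 0 c"

definition Var :: "'x \<Rightarrow> 'x sym_alg" where
  "Var x = Poly_Mapping.single (Poly_Mapping.single x 1) 1"

definition smult :: "complex \<Rightarrow> 'x sym_alg \<Rightarrow> 'x sym_alg" where
  "smult c p = Const c * p"

text \<open>The \<open>\<complex>\<close>-algebra homomorphism sending each \<open>Var x\<close> to \<open>f x\<close>.\<close>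

definition subst :: "('x \<Rightarrow> 'y sym_alg) \<Rightarrow> 'x sym_alg \<Rightarrow> 'y sym_alg" where
  "subst f p = (\<Sum>m\<in>Poly_Mapping.keys p. smult (Poly_Mapping.lookup p m)
     (\<Prod>x\<in>Poly_Mapping.keys m. f x ^ Poly_Mapping.lookup m x))"

text \<open>\<open>Sym X n\<close> is the \<open>n\<close>-th symmetric power of the subspace spanned by the basis vectors in \<open>X\<close>.\<close>

definition Sym :: "'x set \<Rightarrow> nat \<Rightarrow> 'x sym_alg set" where
  "Sym X n = {p. \<forall>m\<in>Poly_Mapping.keys p. Poly_Mapping.keys m \<subseteq> X \<and>
     (\<Sum>x\<in>Poly_Mapping.keys m. Poly_Mapping.lookup m x) = n}"

lemma Const_add: "Const (a + b) = Const a + Const b"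
  by (simp add: Const_def Poly_Mapping.single_add)

lemma Const_mult: "Const (a * b) = Const a * Const b"
  by (simp add: Const_def Poly_Mapping.mult_single)

lemma Const_1: "Const 1 = 1"
  by (simp add: Const_def)

global_interpretation sym_alg: vector_space "smult :: complex \<Rightarrow> 'x sym_alg \<Rightarrow> 'x sym_alg"
  by unfold_locales (simp_all add: smult_def Const_add Const_mult Const_1 algebra_simps)

definition linear_on :: "'x sym_alg set \<Rightarrow> ('x sym_alg \<Rightarrow> 'x sym_alg) \<Rightarrow> bool" where
  "linear_on W f \<longleftrightarrow> (\<forall>v\<in>W. \<forall>w\<in>W. f (v + w) = f v + f w) \<and> (\<forall>c. \<forall>v\<in>W. f (smult c v) = smult c (f v))"

definition SL2 :: "(complex^2^2) set" where
  "SL2 = {g. det g = 1}"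

definition sl2_module :: "(complex^2^2 \<Rightarrow> 'x sym_alg \<Rightarrow> 'x sym_alg) \<Rightarrow> 'x sym_alg set \<Rightarrow> bool" where
  "sl2_module \<alpha> W \<longleftrightarrow> sym_alg.subspace W
     \<and> (\<forall>g\<in>SL2. \<alpha> g \<in> W \<rightarrow> W \<and> linear_on W (\<alpha> g))
     \<and> (\<forall>w\<in>W. \<alpha> (mat 1) w = w)
     \<and> (\<forall>g\<in>SL2. \<forall>h\<in>SL2. \<forall>w\<in>W. \<alpha> (g ** h) w = \<alpha> g (\<alpha> h w))"

definition sl2_module_iso ::
  "(complex^2^2 \<Rightarrow> 'x sym_alg \<Rightarrow> 'x sym_alg) \<Rightarrow> 'x sym_alg set \<Rightarrow> 'x sym_alg set \<Rightarrow> ('x sym_alg \<Rightarrow> 'x sym_alg) \<Rightarrow> bool" where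
  "sl2_module_iso \<alpha> W W' f \<longleftrightarrow> sl2_module \<alpha> W \<and> sl2_module \<alpha> W'
     \<and> linear_on W f \<and> bij_betw f W W'
     \<and> (\<forall>g\<in>SL2. \<forall>w\<in>W. f (\<alpha> g w) = \<alpha> g (f w))"

datatype V2_basis = t_vec | u_vec

text \<open>The columns of \<open>g\<close> are the images of \<open>t\<close> and \<open>u\<close> in the standard representation; the action
  is extended to \<open>Sym(V\<^sub>2)\<close> by algebra automorphisms.\<close>

fun V2_act :: "complex^2^2 \<Rightarrow> V2_basis \<Rightarrow> V2_basis sym_alg" where
  "V2_act g t_vec = smult (g$1$1) (Var t_vec) + smult (g$2$1) (Var u_vec)"
| "V2_act g u_vec = smult (g$1$2) (Var t_vec) + smult (g$2$2) (Var u_vec)"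

definition act_SymV2 :: "complex^2^2 \<Rightarrow> V2_basis sym_alg \<Rightarrow> V2_basis sym_alg" where
  "act_SymV2 g = subst (V2_act g)"

text \<open>Basis of \<open>E\<^sup>\<sharp> \<oplus> E\<^sub>d\<close>. The type has infinitely many \<open>a_vec i\<close>; only those with \<open>i \<le> d\<close>
  belong to \<open>E\<^sub>d\<close>, and every space used below is restricted to these.\<close>

datatype E_basis = Q_vec | eu_vec | q_vec | a_vec nat

definition Esharp_basis :: "E_basis set" where
  "Esharp_basis = {Q_vec, eu_vec, q_vec}"

definition Ed_basis :: "nat \<Rightarrow> E_basis set" where
  "Ed_basis d = a_vec ` {0..d}"

text \<open>The identifications of \<open>E\<^sup>\<sharp>\<close> with \<open>Sym\<^sup>2(V\<^sub>2)\<close> (so that \<open>t\<^sup>2 \<leftrightarrow> 2q\<close>, \<open>tu \<leftrightarrow> eu\<close>,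
  \<open>u\<^sup>2 \<leftrightarrow> 2Q\<close>) and of \<open>E\<^sub>d\<close> with \<open>Sym\<^sup>d(V\<^sub>2)\<close>, on basis vectors.\<close>

fun ident_basis :: "nat \<Rightarrow> E_basis \<Rightarrow> V2_basis sym_alg" where
  "ident_basis d Q_vec = smult (1/2) (Var u_vec ^ 2)"
| "ident_basis d eu_vec = Var t_vec * Var u_vec"
| "ident_basis d q_vec = smult (1/2) (Var t_vec ^ 2)"
| "ident_basis d (a_vec i) = Var t_vec ^ (d - i) * Var u_vec ^ i"

text \<open>Linear on \<open>E\<^sup>\<sharp>\<close> and on \<open>E\<^sub>d\<close>; since it is multiplicative, its restriction to \<open>Sym\<^sup>2(E\<^sub>d)\<close> is the
  evaluation map \<open>\<epsilon>\<^bsub>2,d\<^esub>\<close> sending \<open>v\<^sub>1 \<star> v\<^sub>2\<close> to \<open>v\<^sub>1 v\<^sub>2\<close>.\<close>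

definition ident :: "nat \<Rightarrow> E_basis sym_alg \<Rightarrow> V2_basis sym_alg" where
  "ident d = subst (ident_basis d)"

definition Ker_eps :: "nat \<Rightarrow> E_basis sym_alg set" where
  "Ker_eps d = {p \<in> Sym (Ed_basis d) 2. ident d p = 0}"

text \<open>The action on \<open>E\<^sup>\<sharp> = Sym Esharp_basis 1\<close> and on \<open>E\<^sub>d = Sym (Ed_basis d) 1\<close> is transported from
  \<open>Sym(V\<^sub>2)\<close> through the identification on each summand separately (for \<open>d = 2\<close> the two summands
  have the same image), and extended to \<open>Sym(E\<^sup>\<sharp> \<oplus> E\<^sub>d)\<close> by algebra automorphisms.\<close>

definition E_act :: "nat \<Rightarrow> complex^2^2 \<Rightarrow> E_basis \<Rightarrow> E_basis sym_alg" where
  "E_act d g x = the_inv_into (Sym (if x \<in> Esharp_basis then Esharp_basis else Ed_basis d) 1) (ident d)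
     (act_SymV2 g (ident_basis d x))"

definition act :: "nat \<Rightarrow> complex^2^2 \<Rightarrow> E_basis sym_alg \<Rightarrow> E_basis sym_alg" where
  "act d g = subst (E_act d g)"

datatype Psi_var = T0 | T1 | T2  \<comment> \<open>\<open>T\<close>, \<open>T'\<close>, \<open>T''\<close>\<close>

fun Psi :: "nat \<Rightarrow> Psi_var sym_alg" where
  "Psi 0 = 1"
| "Psi (Suc 0) = Var T0"
| "Psi (Suc (Suc i)) = Var T0 * Psi (Suc i) - Var T1 * Var T2 * Psi i"

definition Psi_star :: "nat \<Rightarrow> E_basis sym_alg \<Rightarrow> E_basis sym_alg \<Rightarrow> E_basis sym_alg \<Rightarrow> E_basis sym_alg" where
  "Psi_star i e e' e'' = subst (\<lambda>v. case v of T0 \<Rightarrow> e | T1 \<Rightarrow> e' | T2 \<Rightarrow> e'') (Psi i)"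

text \<open>\<open>\<rho>\<close> is a linear map \<open>Ker(\<epsilon>\<^bsub>2,d\<^esub>) \<rightarrow> Sym\<^bsup>d-2\<^esup>(E\<^sup>\<sharp>)\<close> with the prescribed values on the basis. It is
  required to be \<open>undefined\<close> outside the kernel, so that it can be unique as a total function.\<close>

definition is_rho :: "nat \<Rightarrow> (E_basis sym_alg \<Rightarrow> E_basis sym_alg) \<Rightarrow> bool" where
  "is_rho d \<rho> \<longleftrightarrow> \<rho> \<in> Ker_eps d \<rightarrow>\<^sub>E Sym Esharp_basis (d - 2) \<and> linear_on (Ker_eps d) \<rho> \<and>
     (\<forall>i j. 1 \<le> i \<and> i \<le> j \<and> j \<le> d - 1 \<longrightarrow>
        \<rho> (Var (a_vec (i - 1)) * Var (a_vec (j + 1)) - Var (a_vec i) * Var (a_vec j)) =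
          Var q_vec ^ (d - j - 1) * Var Q_vec ^ (i - 1) * Psi_star (j - i) (Var eu_vec) (Var q_vec) (Var Q_vec))"

end

theory Submission
  imports Defs
begin

text \<open>
  Write \<open>t\<^sub>1, u\<^sub>1, t\<^sub>2, u\<^sub>2\<close> for the coordinates of two copies of \<open>V\<^sub>2\<close>. Polarization sends \<open>q, eu, Q\<close> to
  \<open>t\<^sub>1 t\<^sub>2\<close>, \<open>t\<^sub>1 u\<^sub>2 + u\<^sub>1 t\<^sub>2\<close>, \<open>u\<^sub>1 u\<^sub>2\<close> and \<open>a\<^sub>k \<star> a\<^sub>l\<close> to the symmetrization of
  \<open>t\<^sub>1\<^bsup>d-k\<^esup> u\<^sub>1\<^bsup>k\<^esup> t\<^sub>2\<^bsup>d-l\<^esup> u\<^sub>2\<^bsup>l\<^esup>\<close>. With \<open>\<Delta> = t\<^sub>1 u\<^sub>2 - u\<^sub>1 t\<^sub>2\<close>, the polarization of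
  \<open>a\<^bsub>i-1\<^esub> \<star> a\<^bsub>j+1\<^esub> - a\<^sub>i \<star> a\<^sub>j\<close> is \<open>\<Delta>\<^sup>2\<close> times that of \<open>q\<^bsup>d-j-1\<^esup> Q\<^bsup>i-1\<^esup> \<Psi>\<^bsub>j-i\<^esub>(eu, q, Q)\<close>: up to
  polarization, \<open>\<rho>\<close> is division by \<open>\<Delta>\<^sup>2\<close>. Since polarization is equivariant and \<open>\<Delta>\<close> is
  \<open>SL\<^sub>2\<close>-invariant, \<open>\<rho>\<close> is equivariant; it is injective because polarization is injective on \<open>Sym\<^sup>2(E\<^sub>d)\<close>, and
  surjective because its values span \<open>Sym\<^bsup>d-2\<^esup>(E\<^sup>\<sharp>)\<close>.
\<close>

section \<open>Linear and multiplicative extension\<close>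

global_interpretation sym_alg_pair: vector_space_pair
  "smult :: complex \<Rightarrow> 'x sym_alg \<Rightarrow> 'x sym_alg" "smult :: complex \<Rightarrow> 'y sym_alg \<Rightarrow> 'y sym_alg"
  by unfold_locales

abbreviation lin :: "('x sym_alg \<Rightarrow> 'y sym_alg) \<Rightarrow> bool" where
  "lin \<equiv> Vector_Spaces.linear smult smult"

abbreviation monom :: "('x \<Rightarrow>\<^sub>0 nat) \<Rightarrow> 'x sym_alg" where
  "monom m \<equiv> Poly_Mapping.single m 1"

text \<open>Prescribes a linear map by arbitrary values on monomials. Unlike \<open>subst\<close> it
  need not be multiplicative, which suits the inverses and normal forms built below.\<close>

definition extend :: "(('x \<Rightarrow>\<^sub>0 nat) \<Rightarrow> 'y sym_alg) \<Rightarrow> 'x sym_alg \<Rightarrow> 'y sym_alg" where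
  "extend h p = (\<Sum>m\<in>Poly_Mapping.keys p. smult (Poly_Mapping.lookup p m) (h m))"

lemma lin_iff:
  "lin f \<longleftrightarrow> (\<forall>v w. f (v + w) = f v + f w) \<and> (\<forall>c v. f (smult c v) = smult c (f v))"
  by (simp add: Vector_Spaces.linear_iff sym_alg.vector_space_axioms)

lemma lin_add: "lin f \<Longrightarrow> f (v + w) = f v + f w"
  and lin_smult: "lin f \<Longrightarrow> f (smult c v) = smult c (f v)"
  by (auto simp: lin_iff)

lemma lin_compose: "lin f \<Longrightarrow> lin g \<Longrightarrow> lin (\<lambda>x. g (f x))"
  by (simp add: lin_iff)

lemma lin_diff: "lin f \<Longrightarrow> f (v - w) = f v - f w"
  by (rule sym_alg_pair.linear_diff)

lemma smult_single: "smult c (Poly_Mapping.single m a) = Poly_Mapping.single m (c * a)"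
  by (simp add: smult_def Const_def Poly_Mapping.mult_single)

lemma lookup_smult: "Poly_Mapping.lookup (smult c p) m = c * Poly_Mapping.lookup p m"
  by (simp add: smult_def Const_def mult_map_scale_conv_mult[symmetric] Poly_Mapping.map.rep_eq when_def)

lemma extend_superset:
  assumes "finite A" "Poly_Mapping.keys p \<subseteq> A"
  shows "extend h p = (\<Sum>m\<in>A. smult (Poly_Mapping.lookup p m) (h m))"
  unfolding extend_def by (rule sum.mono_neutral_left) (use assms in \<open>auto simp: in_keys_iff\<close>)

lemma lin_extend: "lin (extend h)"
proof -
  have "extend h (v + w) = extend h v + extend h w" for v w
    by (simp add: extend_superset[where A = "Poly_Mapping.keys v \<union> Poly_Mapping.keys w"]
        Poly_Mapping.keys_add lookup_add sym_alg.scale_left_distrib sum.distrib)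
  moreover have "extend h (smult c v) = smult c (extend h v)" for c v
    by (subst (1 2) extend_superset[where A = "Poly_Mapping.keys v"])
       (auto simp: in_keys_iff lookup_smult sym_alg.scale_sum_right)
  ultimately show ?thesis by (simp add: lin_iff)
qed

lemma extend_monom: "extend h (monom m) = h m"
  by (simp add: extend_def)

lemma monom_expansion: "p = (\<Sum>m\<in>Poly_Mapping.keys p. smult (Poly_Mapping.lookup p m) (monom m))"
  by (rule poly_mapping_eqI)
     (auto simp: lookup_sum smult_single lookup_single when_def in_keys_iff sum.delta)

lemma span_monom: "p \<in> sym_alg.span (monom ` Poly_Mapping.keys p)"
proof -
  have "(\<Sum>m\<in>Poly_Mapping.keys p. smult (Poly_Mapping.lookup p m) (monom m))
      \<in> sym_alg.span (monom ` Poly_Mapping.keys p)"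
    by (intro sym_alg.span_sum sym_alg.span_scale sym_alg.span_base) auto
  then show ?thesis by (simp only: monom_expansion[symmetric])
qed

lemma lin_eq_on_span:
  assumes "lin f" "lin g" "\<And>b. b \<in> B \<Longrightarrow> f b = g b" "x \<in> sym_alg.span B"
  shows "f x = g x"
  by (rule sym_alg_pair.linear_eq_on[OF assms(1,2,4)]) (rule assms(3))

lemma lin_eq_on_monoms:
  assumes "lin f" "lin g" "\<And>m. m \<in> Poly_Mapping.keys p \<Longrightarrow> f (monom m) = g (monom m)"
  shows "f p = g p"
  by (rule lin_eq_on_span[OF assms(1,2) _ span_monom]) (use assms(3) in blast)

definition monom_subst :: "('x \<Rightarrow> 'y sym_alg) \<Rightarrow> ('x \<Rightarrow>\<^sub>0 nat) \<Rightarrow> 'y sym_alg" where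
  "monom_subst f m = (\<Prod>x\<in>Poly_Mapping.keys m. f x ^ Poly_Mapping.lookup m x)"

lemma subst_eq_extend: "subst f = extend (monom_subst f)"
  by (simp add: fun_eq_iff subst_def extend_def monom_subst_def)

lemma keys_add_nat: "Poly_Mapping.keys (m + n :: 'x \<Rightarrow>\<^sub>0 nat) = Poly_Mapping.keys m \<union> Poly_Mapping.keys n"
  by (auto simp: in_keys_iff lookup_add)

lemma monom_subst_superset:
  assumes "finite A" "Poly_Mapping.keys m \<subseteq> A"
  shows "monom_subst f m = (\<Prod>x\<in>A. f x ^ Poly_Mapping.lookup m x)"
  unfolding monom_subst_def by (rule prod.mono_neutral_left) (use assms in \<open>auto simp: in_keys_iff\<close>)

lemma monom_subst_add: "monom_subst f (m + n) = monom_subst f m * monom_subst f n"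
  by (simp add: monom_subst_superset[where A = "Poly_Mapping.keys m \<union> Poly_Mapping.keys n"]
      keys_add_nat lookup_add power_add prod.distrib)

lemma lin_subst: "lin (subst f)"
  by (simp add: subst_eq_extend lin_extend)

lemmas subst_add = lin_add[OF lin_subst]
lemmas subst_diff = lin_diff[OF lin_subst]
lemmas subst_smult = lin_smult[OF lin_subst]

lemma subst_monom: "subst f (monom m) = monom_subst f m"
  by (simp add: subst_eq_extend extend_monom)

lemma lin_mult_left: "lin (\<lambda>q. p * q)"
  by (simp add: lin_iff smult_def algebra_simps)

lemma lin_mult_right: "lin (\<lambda>q. q * p)"
  by (simp add: lin_iff smult_def algebra_simps)

lemma subst_mult: "subst f (p * q) = subst f p * subst f q"
proof -
  \<comment> \<open>Bilinearity allows reduction to monomials one factor at a time: first in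
    \<open>q\<close>, with the left factor already a monomial, then in \<open>p\<close>.\<close>
  have *: "subst f (monom m * q) = subst f (monom m) * subst f q" for m
    by (rule lin_eq_on_monoms[OF lin_compose[OF lin_mult_left lin_subst] lin_compose[OF lin_subst lin_mult_left]])
       (simp add: Poly_Mapping.mult_single subst_monom monom_subst_add)
  show ?thesis
    by (rule lin_eq_on_monoms[OF lin_compose[OF lin_mult_right lin_subst] lin_compose[OF lin_subst lin_mult_right]])
       (rule *)
qed

lemma subst_1 [simp]: "subst f 1 = 1"
  using subst_monom[of f 0] by (simp add: monom_subst_def)

lemma subst_0 [simp]: "subst f 0 = 0"
  by (simp add: subst_def)

lemma subst_power: "subst f (p ^ n) = subst f p ^ n"
  by (induction n) (simp_all add: subst_mult)

lemma subst_prod: "subst f (prod g A) = (\<Prod>a\<in>A. subst f (g a))"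
  by (induction A rule: infinite_finite_induct) (simp_all add: subst_mult)

lemma subst_Var [simp]: "subst f (Var x) = f x"
  by (simp add: Var_def subst_monom monom_subst_def)

lemma Var_power: "Var x ^ n = monom (Poly_Mapping.single x n)"
  by (induction n) (simp_all add: Var_def Poly_Mapping.mult_single Poly_Mapping.single_add[symmetric])

lemma monom_eq_prod:
  "monom m = (\<Prod>x\<in>Poly_Mapping.keys m. Var x ^ Poly_Mapping.lookup m x)"
proof -
  have "(\<Prod>x\<in>A. monom (g x)) = monom (\<Sum>x\<in>A. g x)" for A and g :: "'a \<Rightarrow> 'a \<Rightarrow>\<^sub>0 nat"
    by (induction A rule: infinite_finite_induct) (simp_all add: Poly_Mapping.mult_single)
  moreover have "m = (\<Sum>x\<in>Poly_Mapping.keys m. Poly_Mapping.single x (Poly_Mapping.lookup m x))"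
    by (rule poly_mapping_eqI) (auto simp: lookup_sum lookup_single when_def in_keys_iff sum.delta)
  ultimately show ?thesis by (simp add: Var_power)
qed

section \<open>Homogeneous components\<close>

definition exps :: "'x set \<Rightarrow> nat \<Rightarrow> ('x \<Rightarrow>\<^sub>0 nat) set" where
  "exps X n = {m. Poly_Mapping.keys m \<subseteq> X \<and> (\<Sum>x\<in>Poly_Mapping.keys m. Poly_Mapping.lookup m x) = n}"

lemma Sym_iff: "p \<in> Sym X n \<longleftrightarrow> Poly_Mapping.keys p \<subseteq> exps X n"
  by (auto simp: Sym_def exps_def)

lemma subspace_Sym: "sym_alg.subspace (Sym X n)"
proof -
  have "Poly_Mapping.keys (p + q) \<subseteq> Poly_Mapping.keys p \<union> Poly_Mapping.keys q"
    "Poly_Mapping.keys (smult c p) \<subseteq> Poly_Mapping.keys p" for c and p q :: "'a sym_alg"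
    by (auto simp: Poly_Mapping.keys_add in_keys_iff lookup_smult)
  then show ?thesis
    unfolding sym_alg.subspace_def Sym_iff by (simp add: Ball_def Sym_iff) (meson order_trans Un_least)
qed

lemmas Sym_add = sym_alg.subspace_add[OF subspace_Sym]
lemmas Sym_diff = sym_alg.subspace_diff[OF subspace_Sym]
lemmas Sym_smult = sym_alg.subspace_scale[OF subspace_Sym]

lemma monom_Sym: "m \<in> exps X n \<Longrightarrow> monom m \<in> Sym X n"
  by (simp add: Sym_iff)

lemma Sym_eq_span: "Sym X n = sym_alg.span (monom ` exps X n)"
proof
  show "Sym X n \<subseteq> sym_alg.span (monom ` exps X n)"
  proof
    fix p assume "p \<in> Sym X n"
    then have "sym_alg.span (monom ` Poly_Mapping.keys p) \<subseteq> sym_alg.span (monom ` exps X n)"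
      by (intro sym_alg.span_mono image_mono) (simp add: Sym_iff)
    then show "p \<in> sym_alg.span (monom ` exps X n)"
      using span_monom by blast
  qed
  show "sym_alg.span (monom ` exps X n) \<subseteq> Sym X n"
    by (rule sym_alg.span_minimal[OF _ subspace_Sym]) (auto simp: monom_Sym)
qed

lemma lin_eq_on_Sym:
  assumes "lin f" "lin g" "\<And>m. m \<in> exps X n \<Longrightarrow> f (monom m) = g (monom m)" "p \<in> Sym X n"
  shows "f p = g p"
  by (rule lin_eq_on_monoms[OF assms(1,2)]) (use assms(3,4) in \<open>auto simp: Sym_iff\<close>)

lemma exps_add:
  assumes "m \<in> exps X k" "n \<in> exps X l"
  shows "m + n \<in> exps X (k + l)"
proof -
  have *: "(\<Sum>x\<in>Poly_Mapping.keys m. Poly_Mapping.lookup m x)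
    = (\<Sum>x\<in>Poly_Mapping.keys m \<union> Poly_Mapping.keys n. Poly_Mapping.lookup m x)"
   "(\<Sum>x\<in>Poly_Mapping.keys n. Poly_Mapping.lookup n x)
    = (\<Sum>x\<in>Poly_Mapping.keys m \<union> Poly_Mapping.keys n. Poly_Mapping.lookup n x)"
    by (rule sum.mono_neutral_left; auto simp: in_keys_iff)+
  show ?thesis using assms
    by (auto simp: exps_def keys_add_nat lookup_add sum.distrib *)
qed

lemma Sym_mult:
  assumes "p \<in> Sym X k" "q \<in> Sym X l"
  shows "p * q \<in> Sym X (k + l)"
  unfolding Sym_iff
proof
  fix m assume "m \<in> Poly_Mapping.keys (p * q)"
  then obtain a b where "a \<in> Poly_Mapping.keys p" "b \<in> Poly_Mapping.keys q" "m = a + b"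
    using keys_mult[of p q] by blast
  then show "m \<in> exps X (k + l)"
    using assms exps_add[of a X k b l] by (auto simp: Sym_iff)
qed

lemma Sym_1: "1 \<in> Sym X 0"
  by (simp add: Sym_iff exps_def)

lemma Sym_power: "p \<in> Sym X k \<Longrightarrow> p ^ n \<in> Sym X (n * k)"
  by (induction n) (auto intro: Sym_1 Sym_mult)

lemma Sym_prod: "(\<And>a. a \<in> A \<Longrightarrow> g a \<in> Sym X (k a)) \<Longrightarrow> finite A \<Longrightarrow> prod g A \<in> Sym X (sum k A)"
  by (induction A rule: infinite_finite_induct) (auto intro: Sym_1 Sym_mult)

lemma Var_Sym: "x \<in> X \<Longrightarrow> Var x \<in> Sym X (Suc 0)"
  by (simp add: Var_def monom_Sym exps_def)

lemma exps_0: "exps X 0 = {0}"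
proof -
  have "m = 0" if "m \<in> exps X 0" for m
  proof -
    have "Poly_Mapping.keys m = {}"
      using that by (auto simp: exps_def in_keys_iff simp del: keys_eq_empty)
    then show ?thesis by simp
  qed
  then show ?thesis by (auto simp: exps_def)
qed

lemma exps_SucE:
  assumes "m \<in> exps X (Suc n)"
  obtains x m' where "x \<in> X" "m' \<in> exps X n" "m = Poly_Mapping.single x 1 + m'"
proof -
  have "Poly_Mapping.keys m \<noteq> {}"
    using assms by (auto simp: exps_def simp del: keys_eq_empty)
  then obtain x where x: "x \<in> Poly_Mapping.keys m" by blast
  define m' where "m' = m - Poly_Mapping.single x 1"
  have m: "m = Poly_Mapping.single x 1 + m'"
  proof (rule poly_mapping_eqI)
    fix k
    have "Poly_Mapping.lookup m x \<noteq> 0" using x by (simp add: in_keys_iff)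
    then show "Poly_Mapping.lookup m k = Poly_Mapping.lookup (Poly_Mapping.single x 1 + m') k"
      by (cases "k = x") (auto simp: m'_def lookup_add lookup_minus lookup_single when_def)
  qed
  define k where "k = (\<Sum>x\<in>Poly_Mapping.keys m'. Poly_Mapping.lookup m' x)"
  have sub: "Poly_Mapping.keys m' \<subseteq> X" "x \<in> X"
  proof -
    have "Poly_Mapping.keys m = insert x (Poly_Mapping.keys m')"
      by (subst m) (simp add: keys_add_nat)
    moreover have "Poly_Mapping.keys m \<subseteq> X" using assms by (simp add: exps_def)
    ultimately show "Poly_Mapping.keys m' \<subseteq> X" "x \<in> X" by auto
  qed
  \<comment> \<open>The degree \<open>k\<close> of \<open>m'\<close> is found by adding the removed
    variable back, so no sum of truncated differences has to be evaluated.\<close>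
  have "m \<in> exps X (1 + k)"
    by (subst m, rule exps_add) (use sub in \<open>simp_all add: exps_def k_def\<close>)
  then have "k = n" using assms by (simp add: exps_def)
  then show thesis using that[of x m'] sub m by (simp add: exps_def k_def)
qed

lemma monom_add: "monom (m + n) = monom m * monom n"
  by (simp add: Poly_Mapping.mult_single)

lemma exps_1: "monom ` exps X 1 = Var ` X"
proof -
  have "exps X 1 = (\<lambda>x. Poly_Mapping.single x 1) ` X"
  proof (intro equalityI subsetI)
    fix m assume "m \<in> exps X 1"
    then show "m \<in> (\<lambda>x. Poly_Mapping.single x 1) ` X"
      unfolding One_nat_def by (elim exps_SucE) (auto simp: exps_0)
  qed (auto simp: exps_def)
  then show ?thesis by (simp add: image_image Var_def)
qed

lemma exps_2E:
  assumes "m \<in> exps X 2"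
  obtains x y where "x \<in> X" "y \<in> X" "monom m = Var x * Var y"
proof -
  obtain x m' where m: "x \<in> X" "m' \<in> exps X 1" "m = Poly_Mapping.single x 1 + m'"
    using assms by (metis Suc_1 exps_SucE)
  moreover from m(2) obtain y where "y \<in> X" "monom m' = Var y"
    using exps_1[of X] by blast
  ultimately show thesis using that by (simp add: monom_add Var_def)
qed

text \<open>Identities about the action must be tested only on the variables of one summand: at
  \<open>a_vec i\<close> with \<open>i > d\<close>, \<open>E_act\<close> may invert
  \<open>ident d\<close> outside its range.\<close>

lemma subst_cong_Sym:
  assumes "\<And>x. x \<in> X \<Longrightarrow> f x = g x" "p \<in> Sym X n"
  shows "subst f p = subst g p"
  by (rule lin_eq_on_Sym[OF lin_subst lin_subst _ assms(2)])
     (auto simp: subst_monom monom_subst_def exps_def subset_iff assms(1) intro!: prod.cong)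

lemma subst_subst: "subst f (subst g p) = subst (\<lambda>x. subst f (g x)) p"
  by (rule lin_eq_on_monoms[OF lin_compose[OF lin_subst lin_subst] lin_subst])
     (simp add: subst_monom monom_subst_def subst_prod subst_power)

lemma subst_Var_id: "subst Var p = p"
proof -
  have "lin (\<lambda>p. p)" by (simp add: lin_iff)
  from lin_eq_on_monoms[OF lin_subst this] show ?thesis
    by (metis subst_monom monom_subst_def monom_eq_prod)
qed

lemma subst_Sym:
  assumes "\<And>x. x \<in> X \<Longrightarrow> f x \<in> Sym Y e" "p \<in> Sym X n"
  shows "subst f p \<in> Sym Y (n * e)"
proof -
  have "subst f (monom m) \<in> Sym Y (n * e)" if "m \<in> exps X n" for m
  proof -
    have "monom_subst f m \<in> Sym Y (\<Sum>x\<in>Poly_Mapping.keys m. Poly_Mapping.lookup m x * e)"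
      unfolding monom_subst_def using that by (intro Sym_prod Sym_power assms(1)) (auto simp: exps_def)
    also have "(\<Sum>x\<in>Poly_Mapping.keys m. Poly_Mapping.lookup m x * e) = n * e"
      using that by (simp add: exps_def sum_distrib_right[symmetric])
    finally show ?thesis by (simp add: subst_monom)
  qed
  then have "Sym X n \<subseteq> {p. subst f p \<in> Sym Y (n * e)}"
    unfolding Sym_eq_span[of X n]
    by (intro sym_alg.span_minimal)
       (auto simp: sym_alg.subspace_def subst_add subst_smult intro: Sym_add Sym_smult
             sym_alg.subspace_0[OF subspace_Sym])
  then show ?thesis using assms(2) by auto
qed

section \<open>The action on the two summands\<close>

text \<open>In a fixed degree the exponent of \<open>u_vec\<close> alone identifies a monomial, so
  linear maps on that degree can be prescribed through it.\<close>

lemma exps_V2E: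
  assumes "m \<in> exps UNIV n"
  obtains i where "i \<le> n" "monom m = Var t_vec ^ (n - i) * Var u_vec ^ i" "Poly_Mapping.lookup m u_vec = i"
proof -
  define a b where "a = Poly_Mapping.lookup m t_vec" and "b = Poly_Mapping.lookup m u_vec"
  have m: "m = Poly_Mapping.single t_vec a + Poly_Mapping.single u_vec b"
  proof (rule poly_mapping_eqI)
    fix x show "Poly_Mapping.lookup m x
        = Poly_Mapping.lookup (Poly_Mapping.single t_vec a + Poly_Mapping.single u_vec b) x"
      by (cases x) (simp_all add: a_def b_def lookup_add lookup_single)
  qed
  have "Poly_Mapping.single x c \<in> exps UNIV c" for x :: V2_basis and c
    by (simp add: exps_def)
  then have "m \<in> exps UNIV (a + b)"
    by (subst m) (intro exps_add)
  then have n: "n = a + b" using assms by (simp add: exps_def)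
  have "monom m = Var t_vec ^ a * Var u_vec ^ b"
    by (subst m) (simp add: Var_power monom_add)
  with n have "b \<le> n" "monom m = Var t_vec ^ (n - b) * Var u_vec ^ b" by simp_all
  then show thesis by (rule that) (simp add: b_def)
qed

lemma ident_basis_a: "ident_basis d (a_vec i)
    = monom (Poly_Mapping.single t_vec (d - i) + Poly_Mapping.single u_vec i)"
  by (simp add: Var_power monom_add)

lemma lin_ident: "lin (ident d)"
  by (simp add: ident_def lin_subst)

lemma ident_Var [simp]: "ident d (Var x) = ident_basis d x"
  by (simp add: ident_def)

lemma ident_mult: "ident d (p * q) = ident d p * ident d q"
  by (simp add: ident_def subst_mult)

lemma lin_act_SymV2: "lin (act_SymV2 g)"
  by (simp add: act_SymV2_def lin_subst)

lemma lin_act: "lin (act d g)"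
  by (simp add: act_def lin_subst)

lemma linear_on_lin: "lin f \<Longrightarrow> linear_on W f"
  by (simp add: lin_iff linear_on_def)

lemma subspace_vimage_lin:
  assumes "lin f" "sym_alg.subspace W"
  shows "sym_alg.subspace {p. f p \<in> W}"
  using assms sym_alg_pair.linear_0[OF assms(1)] by (simp add: sym_alg.subspace_def lin_iff)

lemma lin_image_span:
  assumes "lin f" "sym_alg.subspace W" "\<And>b. b \<in> B \<Longrightarrow> f b \<in> W" "p \<in> sym_alg.span B"
  shows "f p \<in> W"
  using sym_alg.span_minimal[OF _ subspace_vimage_lin[OF assms(1,2)], of B] assms(3,4) by auto

lemma Sym_1_eq_span: "Sym X (Suc 0) = sym_alg.span (Var ` X)"
  using exps_1[of X] by (simp add: Sym_eq_span)

text \<open>Both composites of \<open>L\<close> with \<open>ident d\<close> are linear, so basis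
  vectors suffice. \<open>L\<close> is total, but only its values in degree \<open>e\<close>
  matter.\<close>

lemma ident_bij_betw_of_inverse:
  assumes L: "lin L"
    and X: "\<And>x. x \<in> X \<Longrightarrow> ident_basis d x \<in> Sym UNIV e \<and> L (ident_basis d x) = Var x"
    and U: "\<And>m. m \<in> exps UNIV e \<Longrightarrow> L (monom m) \<in> Sym X (Suc 0) \<and> ident d (L (monom m)) = monom m"
  shows "bij_betw (ident d) (Sym X (Suc 0)) (Sym UNIV e)"
proof (rule bij_betw_byWitness[where f' = L])
  have id: "lin (\<lambda>p. p)" by (simp add: lin_iff)
  show "\<forall>v\<in>Sym X (Suc 0). L (ident d v) = v"
    unfolding Sym_1_eq_span
    by (intro ballI, rule lin_eq_on_span[OF lin_compose[OF lin_ident L] id, where B = "Var ` X"]) (auto simp: X)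
  show "\<forall>v\<in>Sym UNIV e. ident d (L v) = v"
    by (intro ballI, rule lin_eq_on_Sym[OF lin_compose[OF L lin_ident] id, where X = UNIV and n = e]) (auto simp: U)
  show "ident d ` Sym X (Suc 0) \<subseteq> Sym UNIV e"
    unfolding Sym_1_eq_span
    by (intro image_subsetI, rule lin_image_span[OF lin_ident subspace_Sym, where B = "Var ` X"]) (auto simp: X)
  show "L ` Sym UNIV e \<subseteq> Sym X (Suc 0)"
    unfolding Sym_eq_span[of UNIV e]
    by (intro image_subsetI, rule lin_image_span[OF L subspace_Sym, where B = "monom ` exps UNIV e"])
       (auto simp: U)
qed

text \<open>Under the identifications, the summand with basis \<open>X\<close> is \<open>Sym\<^sup>e(V\<^sub>2)\<close>.\<close>

definition summand :: "nat \<Rightarrow> E_basis set \<Rightarrow> nat \<Rightarrow> bool" where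
  "summand d X e \<longleftrightarrow> X = Esharp_basis \<and> e = 2 \<or> X = Ed_basis d \<and> e = d"

lemma ident_bij_betw_Esharp: "bij_betw (ident d) (Sym Esharp_basis (Suc 0)) (Sym UNIV 2)"
proof (rule ident_bij_betw_of_inverse)
  \<comment> \<open>The inverse on t^2, tu, u^2, told apart by the exponent of u; the factors 2 undo
    the halves in \<open>ident_basis\<close>.\<close>
  define h where "h = (\<lambda>m :: V2_basis \<Rightarrow>\<^sub>0 nat. if Poly_Mapping.lookup m u_vec = 0 then smult 2 (Var q_vec)
    else if Poly_Mapping.lookup m u_vec = 1 then Var eu_vec else smult 2 (Var Q_vec))"
  show "lin (extend h)" by (rule lin_extend)
  show "ident_basis d x \<in> Sym UNIV 2 \<and> extend h (ident_basis d x) = Var x"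
    if "x \<in> Esharp_basis" for x
  proof -
    have V: "Var x \<in> Sym UNIV (1::nat)" for x :: V2_basis by (rule Var_Sym[unfolded One_nat_def[symmetric]]) simp
    have "Var t_vec ^ 2 \<in> Sym UNIV 2" "Var u_vec ^ 2 \<in> Sym UNIV 2" "Var t_vec * Var u_vec \<in> Sym UNIV 2"
      using Sym_power[OF V, of _ 2] Sym_mult[OF V V] by (simp_all add: numeral_2_eq_2)
    moreover have "Var t_vec * Var u_vec = monom (Poly_Mapping.single t_vec 1 + Poly_Mapping.single u_vec 1)"
      by (simp add: Var_def monom_add)
    ultimately show ?thesis using that
      by (auto simp: Esharp_basis_def lin_smult[OF lin_extend] Var_power extend_monom h_def lookup_add
          lookup_single intro!: Sym_smult)
  qed
  fix m :: "V2_basis \<Rightarrow>\<^sub>0 nat" assume "m \<in> exps UNIV 2"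
  then obtain i where i: "i \<le> 2" "monom m = Var t_vec ^ (2 - i) * Var u_vec ^ i" "Poly_Mapping.lookup m u_vec = i"
    by (rule exps_V2E)
  have "i = 0 \<or> i = 1 \<or> i = 2" using i(1) by auto
  then have "h m \<in> Sym Esharp_basis (Suc 0) \<and> ident d (h m) = monom m"
    using i by (auto simp: h_def lin_smult[OF lin_ident] Esharp_basis_def intro!: Sym_smult Var_Sym)
  then show "extend h (monom m) \<in> Sym Esharp_basis (Suc 0) \<and> ident d (extend h (monom m)) = monom m"
    by (simp add: extend_monom)
qed

lemma ident_bij_betw_Ed: "bij_betw (ident d) (Sym (Ed_basis d) (Suc 0)) (Sym UNIV d)"
proof (rule ident_bij_betw_of_inverse)
  define h where "h m = Var (a_vec (Poly_Mapping.lookup m u_vec))" for m :: "V2_basis \<Rightarrow>\<^sub>0 nat"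
  show "lin (extend h)" by (rule lin_extend)
  show "ident_basis d x \<in> Sym UNIV d \<and> extend h (ident_basis d x) = Var x"
    if "x \<in> Ed_basis d" for x
  proof -
    obtain i where i: "x = a_vec i" "i \<le> d" using \<open>x \<in> Ed_basis d\<close> by (auto simp: Ed_basis_def)
    have "Poly_Mapping.single y c \<in> exps UNIV c" for y :: V2_basis and c
      by (simp add: exps_def)
    then have "Poly_Mapping.single t_vec (d - i) + Poly_Mapping.single u_vec i \<in> exps UNIV (d - i + i)"
      by (intro exps_add)
    with i(2) have "monom (Poly_Mapping.single t_vec (d - i) + Poly_Mapping.single u_vec i) \<in> Sym UNIV d"
      by (intro monom_Sym) simp
    then show ?thesis
      unfolding i(1) ident_basis_a by (simp add: extend_monom h_def lookup_add lookup_single)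
  qed
  fix m :: "V2_basis \<Rightarrow>\<^sub>0 nat" assume "m \<in> exps UNIV d"
  then obtain i where i: "i \<le> d" "monom m = Var t_vec ^ (d - i) * Var u_vec ^ i" "Poly_Mapping.lookup m u_vec = i"
    by (rule exps_V2E)
  then have "h m \<in> Sym (Ed_basis d) (Suc 0) \<and> ident d (h m) = monom m"
    using Var_Sym[of "a_vec i" "Ed_basis d"] by (simp add: h_def Ed_basis_def)
  then show "extend h (monom m) \<in> Sym (Ed_basis d) (Suc 0) \<and> ident d (extend h (monom m)) = monom m"
    by (simp add: extend_monom)
qed

lemma ident_bij_betw: "summand d X e \<Longrightarrow> bij_betw (ident d) (Sym X (Suc 0)) (Sym UNIV e)"
  by (auto simp: summand_def ident_bij_betw_Esharp ident_bij_betw_Ed)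

lemma act_SymV2_Sym:
  assumes "p \<in> Sym UNIV n"
  shows "act_SymV2 g p \<in> Sym UNIV n"
proof -
  have "V2_act g x \<in> Sym UNIV (Suc 0)" for x
    by (cases x) (auto intro!: Sym_add Sym_smult Var_Sym)
  then show ?thesis
    using subst_Sym[of UNIV "V2_act g" UNIV "Suc 0" p n] assms by (simp add: act_SymV2_def)
qed

text \<open>The action on Sym(V_2) preserves degree, so the vector to be transported lies in the
  range of \<open>ident d\<close>, where \<open>the_inv_into\<close> is a genuine inverse.\<close>

lemma
  assumes "summand d X e" "x \<in> X"
  shows E_act_Sym: "E_act d g x \<in> Sym X (Suc 0)"
    and ident_E_act: "ident d (E_act d g x) = act_SymV2 g (ident_basis d x)"
proof -
  have E: "E_act d g x = the_inv_into (Sym X (Suc 0)) (ident d) (act_SymV2 g (ident_basis d x))"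
    using assms by (auto simp: summand_def E_act_def Esharp_basis_def Ed_basis_def)
  note bij = ident_bij_betw[OF assms(1)]
  have "ident d (Var x) \<in> Sym UNIV e"
    using Var_Sym[OF assms(2)] bij by (rule bij_betw_apply[rotated])
  then have "act_SymV2 g (ident_basis d x) \<in> ident d ` Sym X (Suc 0)"
    using bij by (simp add: act_SymV2_Sym bij_betw_imp_surj_on)
  then show "E_act d g x \<in> Sym X (Suc 0)"
    and "ident d (E_act d g x) = act_SymV2 g (ident_basis d x)"
    unfolding E using bij_betw_imp_inj_on[OF bij] the_inv_into_into[of "ident d" "Sym X (Suc 0)"]
    by (auto simp: f_the_inv_into_f)
qed

lemma act_Sym:
  assumes "summand d X e" "p \<in> Sym X n"
  shows "act d g p \<in> Sym X n"
  using subst_Sym[of X "E_act d g" X "Suc 0" p n] E_act_Sym[OF assms(1)] assms(2) by (simp add: act_def)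

lemma ident_act:
  assumes "summand d X e" "p \<in> Sym X n"
  shows "ident d (act d g p) = act_SymV2 g (ident d p)"
  unfolding act_def ident_def act_SymV2_def subst_subst
  by (rule subst_cong_Sym[OF _ assms(2)])
     (use ident_E_act[OF assms(1)] in \<open>simp add: ident_def act_SymV2_def\<close>)

lemma ident_inject:
  assumes "summand d X e" "p \<in> Sym X (Suc 0)" "q \<in> Sym X (Suc 0)" "ident d p = ident d q"
  shows "p = q"
  by (rule inj_onD[OF bij_betw_imp_inj_on[OF ident_bij_betw[OF assms(1)]] assms(4,2,3)])

lemma act_SymV2_one: "act_SymV2 (mat 1) p = p"
proof -
  have "V2_act (mat 1) x = Var x" for x
    by (cases x) (simp_all add: mat_def)
  then have "V2_act (mat 1) = Var" ..
  then show ?thesis by (simp add: act_SymV2_def subst_Var_id)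
qed

lemma act_SymV2_mult: "act_SymV2 (g ** h) p = act_SymV2 g (act_SymV2 h p)"
proof -
  have "V2_act (g ** h) x = subst (V2_act g) (V2_act h x)" for x
    by (cases x) (simp_all add: subst_add subst_smult matrix_matrix_mult_def sum_2
        sym_alg.scale_left_distrib sym_alg.scale_right_distrib algebra_simps)
  then have "V2_act (g ** h) = (\<lambda>x. subst (V2_act g) (V2_act h x))" ..
  then show ?thesis by (simp add: act_SymV2_def subst_subst)
qed

section \<open>Group laws of the action\<close>

lemma act_one:
  assumes "summand d X e" "p \<in> Sym X n"
  shows "act d (mat 1) p = p"
proof -
  have "E_act d (mat 1) x = Var x" if "x \<in> X" for x
    by (rule ident_inject[OF assms(1)])
       (use that assms(1) in \<open>simp_all add: E_act_Sym Var_Sym ident_E_act act_SymV2_one\<close>)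
  then have "act d (mat 1) p = subst Var p"
    unfolding act_def by (rule subst_cong_Sym[OF _ assms(2)])
  then show ?thesis by (simp add: subst_Var_id)
qed

text \<open>Both sides are substitutions, so variables suffice; there both values have degree 1, and
  injectivity of \<open>ident d\<close> brings the law over from Sym(V_2).\<close>

lemma act_mult:
  assumes "summand d X e" "p \<in> Sym X n"
  shows "act d (g ** h) p = act d g (act d h p)"
  unfolding act_def subst_subst
proof (rule subst_cong_Sym[OF _ assms(2)])
  fix x assume x: "x \<in> X"
  note mem = E_act_Sym[OF assms(1) x]
  show "E_act d (g ** h) x = subst (E_act d g) (E_act d h x)"
    unfolding act_def[symmetric]
    by (rule ident_inject[OF assms(1)])
       (use x mem in \<open>simp_all add: act_Sym[OF assms(1)] ident_act[OF assms(1) mem]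
          ident_E_act[OF assms(1)] act_SymV2_mult\<close>)
qed

lemma sl2_moduleI:
  assumes "summand d X e" "sym_alg.subspace W" "W \<subseteq> Sym X n"
    "\<And>g w. g \<in> SL2 \<Longrightarrow> w \<in> W \<Longrightarrow> act d g w \<in> W"
  shows "sl2_module (act d) W"
  unfolding sl2_module_def
  using assms(2,4) act_one[OF assms(1) subsetD[OF assms(3)]] act_mult[OF assms(1) subsetD[OF assms(3)]]
  by (auto simp: linear_on_lin[OF lin_act])

section \<open>Polarization\<close>

text \<open>Two copies of \<open>V\<^sub>2\<close>: the index \<open>(b, x)\<close> is the vector \<open>x\<close> of the copy \<open>b\<close>.\<close>

type_synonym pair_alg = "(bool \<times> V2_basis) sym_alg"

definition copy :: "bool \<Rightarrow> V2_basis sym_alg \<Rightarrow> pair_alg" where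
  "copy b = subst (\<lambda>x. Var (b, x))"

text \<open>Evaluates a form at the sum of the two vectors; this is what makes a basis-free formula
  for polar forms possible.\<close>

definition diag :: "V2_basis sym_alg \<Rightarrow> pair_alg" where
  "diag = subst (\<lambda>x. Var (True, x) + Var (False, x))"

definition pair_act :: "complex^2^2 \<Rightarrow> pair_alg \<Rightarrow> pair_alg" where
  "pair_act g = subst (\<lambda>(b, x). copy b (V2_act g x))"

lemma lin_copy: "lin (copy b)" and lin_diag: "lin diag" and lin_pair_act: "lin (pair_act g)"
  by (simp_all add: copy_def diag_def pair_act_def lin_subst)

lemma pair_act_copy: "pair_act g (copy b p) = copy b (act_SymV2 g p)"
  by (simp add: pair_act_def copy_def act_SymV2_def subst_subst)

lemma pair_act_diag: "pair_act g (diag p) = diag (act_SymV2 g p)"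
proof -
  have "subst (\<lambda>(b, x). copy b (V2_act g x)) (Var (True, x) + Var (False, x))
      = subst (\<lambda>x. Var (True, x) + Var (False, x)) (V2_act g x)" for x
    by (cases x) (simp_all add: copy_def subst_add subst_smult sym_alg.scale_right_distrib algebra_simps)
  then show ?thesis by (simp add: pair_act_def diag_def act_SymV2_def subst_subst)
qed

fun polar_basis :: "nat \<Rightarrow> E_basis \<Rightarrow> pair_alg" where
  "polar_basis d Q_vec = Var (True, u_vec) * Var (False, u_vec)"
| "polar_basis d eu_vec = Var (True, t_vec) * Var (False, u_vec) + Var (True, u_vec) * Var (False, t_vec)"
| "polar_basis d q_vec = Var (True, t_vec) * Var (False, t_vec)"
| "polar_basis d (a_vec i) = Var (True, t_vec) ^ (d - i) * Var (True, u_vec) ^ i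
     + Var (False, t_vec) ^ (d - i) * Var (False, u_vec) ^ i"

text \<open>On \<open>E\<^sup>\<sharp>\<close> this is the polar form of a quadratic form. On \<open>Ker(\<epsilon>\<^bsub>2,d\<^esub>)\<close> it also is polarization,
  \<open>v \<star> w\<close> going to \<open>v(1) w(2) + w(1) v(2)\<close>: the remaining terms \<open>v(1) w(1) + v(2) w(2)\<close> are
  the two copies of the image under \<open>\<epsilon>\<close>.\<close>

definition polar :: "nat \<Rightarrow> E_basis sym_alg \<Rightarrow> pair_alg" where
  "polar d = subst (polar_basis d)"

definition Delta :: pair_alg where
  "Delta = Var (True, t_vec) * Var (False, u_vec) - Var (True, u_vec) * Var (False, t_vec)"

lemma lin_polar: "lin (polar d)"
  by (simp add: polar_def lin_subst)

lemma smult_half_double: "smult (1/2) (2 * p) = p"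
proof -
  have "smult (1/2) (2 * p) = smult (1/2 + 1/2) p"
    unfolding sym_alg.scale_left_distrib mult_2 sym_alg.scale_right_distrib ..
  then show ?thesis by simp
qed

text \<open>The polarization identity F(x+y) - F(x) - F(y). It describes \<open>polar\<close>
  without coordinates, which makes its equivariance visible; the halves in
  \<open>ident_basis\<close> give coefficient 1 in \<open>polar_basis\<close>.\<close>

lemma polar_Esharp:
  assumes "v \<in> Sym Esharp_basis (Suc 0)"
  shows "polar d v = diag (ident d v) - copy True (ident d v) - copy False (ident d v)"
proof (rule lin_eq_on_span[OF lin_polar _ _ assms[unfolded Sym_1_eq_span]])
  show "lin (\<lambda>v. diag (ident d v) - copy True (ident d v) - copy False (ident d v))"
    by (simp add: lin_iff lin_add[OF lin_ident] lin_smult[OF lin_ident] lin_add[OF lin_copy]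
        lin_smult[OF lin_copy] lin_add[OF lin_diag] lin_smult[OF lin_diag] sym_alg.scale_right_diff_distrib)
  have half: "smult (1/2) ((a + b)\<^sup>2) - smult (1/2) (a\<^sup>2) - smult (1/2) (b\<^sup>2) = a * b" for a b :: pair_alg
  proof -
    have "(a + b)\<^sup>2 - a\<^sup>2 - b\<^sup>2 = 2 * (a * b)" by (simp add: power2_eq_square algebra_simps)
    then show ?thesis by (metis sym_alg.scale_right_diff_distrib smult_half_double)
  qed
  fix b assume "b \<in> Var ` Esharp_basis"
  then show "polar d b = diag (ident d b) - copy True (ident d b) - copy False (ident d b)"
    by (auto simp: Esharp_basis_def polar_def diag_def copy_def subst_smult subst_power subst_mult half)
       (simp add: algebra_simps)
qed

lemma polar_Ed:
  assumes "v \<in> Sym (Ed_basis d) (Suc 0)"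
  shows "polar d v = copy True (ident d v) + copy False (ident d v)"
proof (rule lin_eq_on_span[OF lin_polar _ _ assms[unfolded Sym_1_eq_span]])
  show "lin (\<lambda>v. copy True (ident d v) + copy False (ident d v))"
    by (simp add: lin_iff lin_add[OF lin_ident] lin_smult[OF lin_ident] lin_add[OF lin_copy]
        lin_smult[OF lin_copy] sym_alg.scale_right_distrib)
  fix b assume "b \<in> Var ` Ed_basis d"
  then show "polar d b = copy True (ident d b) + copy False (ident d b)"
    by (auto simp: Ed_basis_def polar_def copy_def subst_power subst_mult)
qed

lemma polar_act:
  assumes "summand d X e" "p \<in> Sym X n"
  shows "polar d (act d g p) = pair_act g (polar d p)"
  unfolding act_def pair_act_def polar_def subst_subst
proof (rule subst_cong_Sym[OF _ assms(2)])
  fix x assume x: "x \<in> X"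
  \<comment> \<open>The basis-free formulas apply to both sides, and \<open>copy\<close> and
    \<open>diag\<close> commute with the action.\<close>
  have "polar d (E_act d g x) = pair_act g (polar d (Var x))"
    using assms(1) E_act_Sym[OF assms(1) x, of g] ident_E_act[OF assms(1) x, of g] Var_Sym[OF x]
    by (auto simp: summand_def polar_Esharp polar_Ed lin_diff[OF lin_pair_act] lin_add[OF lin_pair_act]
        pair_act_copy pair_act_diag)
  then show "subst (polar_basis d) (E_act d g x)
      = subst (\<lambda>(b, x). copy b (V2_act g x)) (polar_basis d x)"
    by (simp add: polar_def pair_act_def)
qed

text \<open>\<open>Delta\<close> is the determinant of the two coordinate vectors, so any
  \<open>g\<close> scales it by \<open>det g\<close>.\<close>

lemma pair_act_Delta:
  assumes "g \<in> SL2"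
  shows "pair_act g Delta = Delta"
proof -
  have Const_diff: "Const (a - b) = Const a - Const b" for a b :: complex
    by (simp add: Const_def single_diff)
  have "pair_act g Delta = smult (det g) Delta"
    by (simp add: det_2 Delta_def pair_act_def copy_def subst_add subst_smult subst_diff subst_mult
        del: One_nat_def)
       (simp add: smult_def Const_mult Const_diff algebra_simps)
  then show ?thesis using assms by (simp add: SL2_def)
qed

section \<open>The kernel and its image\<close>

definition ker_vec :: "nat \<Rightarrow> nat \<Rightarrow> E_basis sym_alg" where
  "ker_vec i j = Var (a_vec (i - 1)) * Var (a_vec (j + 1)) - Var (a_vec i) * Var (a_vec j)"

abbreviation psi :: "nat \<Rightarrow> E_basis sym_alg" where
  "psi k \<equiv> Psi_star k (Var eu_vec) (Var q_vec) (Var Q_vec)"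

definition sharp_vec :: "nat \<Rightarrow> nat \<Rightarrow> nat \<Rightarrow> E_basis sym_alg" where
  "sharp_vec d i j = Var q_vec ^ (d - j - 1) * Var Q_vec ^ (i - 1) * psi (j - i)"

definition ker_vecs :: "nat \<Rightarrow> E_basis sym_alg set" where
  "ker_vecs d = {ker_vec i j |i j. 1 \<le> i \<and> i \<le> j \<and> j \<le> d - 1}"

definition sharp_vecs :: "nat \<Rightarrow> E_basis sym_alg set" where
  "sharp_vecs d = {sharp_vec d i j |i j. 1 \<le> i \<and> i \<le> j \<and> j \<le> d - 1}"

lemma psi_simps [simp]:
  "psi 0 = 1"
  "psi (Suc 0) = Var eu_vec"
  "psi (Suc (Suc k)) = Var eu_vec * psi (Suc k) - Var q_vec * Var Q_vec * psi k"
  by (simp_all add: Psi_star_def subst_diff subst_mult)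

lemma psi_Sym: "psi k \<in> Sym Esharp_basis k"
proof (induction k rule: induct_nat_012)
  case 0
  show ?case by (simp add: Sym_1)
next
  case 1
  show ?case by (simp add: Var_Sym Esharp_basis_def)
next
  case (ge2 k)
  have V: "Var x \<in> Sym Esharp_basis (Suc 0)" if "x \<in> Esharp_basis" for x
    using that by (rule Var_Sym)
  have "Var eu_vec * psi (Suc k) \<in> Sym Esharp_basis (Suc 0 + Suc k)"
    "Var q_vec * Var Q_vec * psi k \<in> Sym Esharp_basis (Suc 0 + Suc 0 + k)"
    using ge2 by (intro Sym_mult V; simp add: Esharp_basis_def)+
  then show ?case by (simp add: Sym_diff)
qed

lemma sharp_vec_Sym:
  assumes "1 \<le> i" "i \<le> j" "j \<le> d - 1"
  shows "sharp_vec d i j \<in> Sym Esharp_basis (d - 2)"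
proof -
  have "sharp_vec d i j \<in> Sym Esharp_basis ((d - j - 1) * Suc 0 + (i - 1) * Suc 0 + (j - i))"
    unfolding sharp_vec_def
    by (intro Sym_mult Sym_power Var_Sym psi_Sym) (simp_all add: Esharp_basis_def)
  moreover have "(d - j - 1) * Suc 0 + (i - 1) * Suc 0 + (j - i) = d - 2"
    using assms by simp
  ultimately show ?thesis by simp
qed

text \<open>Put A = t_1 u_2 and B = u_1 t_2. Polarization sends eu to A + B and qQ to AB, so the
  recurrence becomes that of (A^(k+1) - B^(k+1)) / (A - B), and \<open>Delta\<close> is A -
  B.\<close>

lemma Delta_polar_psi:
  "Delta * polar d (psi k) = (Var (True, t_vec) * Var (False, u_vec)) ^ Suc k
     - (Var (True, u_vec) * Var (False, t_vec)) ^ Suc k"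
proof (induction k rule: induct_nat_012)
  case (ge2 k)
  define A B where "A = Var (True, t_vec) * Var (False, u_vec)"
    and "B = Var (True, u_vec) * Var (False, t_vec)"
  have "Delta * polar d (psi (Suc (Suc k)))
      = (A + B) * (Delta * polar d (psi (Suc k))) - A * B * (Delta * polar d (psi k))"
    by (simp add: polar_def subst_diff subst_mult A_def B_def algebra_simps)
  then show ?case
    unfolding ge2 A_def[symmetric] B_def[symmetric] by (simp add: algebra_simps)
qed (simp_all add: polar_def Delta_def algebra_simps)

text \<open>The terms inside a single copy cancel because (i-1) + (j+1) = i + j. The cross terms
  share the factor (TS)^b (UV)^a, and the rest is (A - B)(A^(k+1) - B^(k+1)) with A = TV, B =
  US.\<close>

lemma polar_ker_vec:
  assumes "1 \<le> i" "i \<le> j" "j \<le> d - 1"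
  shows "polar d (ker_vec i j) = Delta ^ 2 * polar d (sharp_vec d i j)"
proof -
  define a k b where "a = i - 1" and "k = j - i" and "b = d - j - 1"
  have ij: "i = Suc a" "j = Suc (a + k)" "d = Suc (Suc (a + k + b))"
    using assms by (simp_all add: a_def k_def b_def)
  have diffs: "d - a = Suc (Suc (k + b))" "d - Suc (Suc (a + k)) = b"
    "d - Suc a = Suc (k + b)" "d - Suc (a + k) = Suc b"
    by (simp_all add: ij)
  define T U S V :: pair_alg where "T = Var (True, t_vec)" and "U = Var (True, u_vec)"
    and "S = Var (False, t_vec)" and "V = Var (False, u_vec)"
  have "polar d (sharp_vec d i j) = (T * S) ^ b * (U * V) ^ a * polar d (psi k)"
    by (simp add: sharp_vec_def polar_def subst_mult subst_power T_def U_def S_def V_def a_def k_def b_def)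
  then have "Delta ^ 2 * polar d (sharp_vec d i j)
      = (T * V - U * S) * (T * S) ^ b * (U * V) ^ a * (Delta * polar d (psi k))"
    by (simp add: Delta_def power2_eq_square T_def U_def S_def V_def algebra_simps)
  also have "\<dots> = (T * V - U * S) * (T * S) ^ b * (U * V) ^ a * ((T * V) ^ Suc k - (U * S) ^ Suc k)"
    by (simp add: Delta_polar_psi T_def U_def S_def V_def)
  also have "\<dots> = polar d (ker_vec i j)"
    by (simp add: ker_vec_def ij(1,2) polar_def subst_diff subst_mult diffs T_def[symmetric] U_def[symmetric]
        S_def[symmetric] V_def[symmetric])
       (simp add: power_add power_mult_distrib algebra_simps)
  finally show ?thesis by simp
qed

text \<open>Powers of eu are traded for \<open>psi\<close> one at a time by the recurrence read as
  eu * Psi_(k+1) = Psi_(k+2) + qQ * Psi_k, starting from eu = Psi_1.\<close>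

lemma Sym_Esharp_subset_span:
  assumes d: "d \<ge> 2"
  shows "Sym Esharp_basis (d - 2) \<subseteq> sym_alg.span (sharp_vecs d)"
proof -
  have gen: "Var q_vec ^ a * Var Q_vec ^ b * Var eu_vec ^ c * psi k \<in> sym_alg.span (sharp_vecs d)"
    if "a + b + c + k = d - 2" for a b c k
    using that
  proof (induction c arbitrary: a b k)
    case 0
    then have *: "d = Suc (Suc (a + b + k))" using d by simp
    then have "sharp_vec d (Suc b) (Suc (b + k)) \<in> sharp_vecs d"
      unfolding sharp_vecs_def by fastforce
    moreover have "sharp_vec d (Suc b) (Suc (b + k)) = Var q_vec ^ a * Var Q_vec ^ b * psi k"
      by (simp add: sharp_vec_def *)
    ultimately show ?case by (simp add: sym_alg.span_base)
  next
    case (Suc c)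
    show ?case
    proof (cases k)
      case 0
      then show ?thesis using Suc.IH[of a b 1] Suc.prems by (simp add: algebra_simps)
    next
      case (Suc k')
      have "Var q_vec ^ a * Var Q_vec ^ b * Var eu_vec ^ Suc c * psi (Suc k')
          = Var q_vec ^ a * Var Q_vec ^ b * Var eu_vec ^ c * psi (Suc (Suc k'))
            + Var q_vec ^ Suc a * Var Q_vec ^ Suc b * Var eu_vec ^ c * psi k'"
        by (simp add: algebra_simps)
      then show ?thesis
        using Suc.IH[of a b "Suc k"] Suc.IH[of "Suc a" "Suc b" k'] Suc.prems
        unfolding Suc by (simp only:) (rule sym_alg.span_add; simp)
    qed
  qed
  show ?thesis
    unfolding Sym_eq_span
  proof (rule sym_alg.span_minimal)
    show "sym_alg.subspace (sym_alg.span (sharp_vecs d))" by simp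
    show "monom ` exps Esharp_basis (d - 2) \<subseteq> sym_alg.span (sharp_vecs d)"
    proof (rule image_subsetI)
      fix m assume m: "m \<in> exps Esharp_basis (d - 2)"
      then have sub: "Poly_Mapping.keys m \<subseteq> {q_vec, Q_vec, eu_vec}"
        by (auto simp: exps_def Esharp_basis_def)
      let ?l = "Poly_Mapping.lookup m"
      have "(\<Sum>x\<in>Poly_Mapping.keys m. ?l x) = (\<Sum>x\<in>{q_vec, Q_vec, eu_vec}. ?l x)"
        by (rule sum.mono_neutral_left) (use sub in \<open>auto simp: in_keys_iff\<close>)
      \<comment> \<open>The summand 0 is the index \<open>k\<close> in \<open>gen\<close>: a
        monomial is the case \<open>psi 0 = 1\<close>.\<close>
      then have "?l q_vec + ?l Q_vec + ?l eu_vec + 0 = d - 2"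
        using m by (simp add: exps_def)
      note gen[OF this]
      moreover have "monom m = Var q_vec ^ ?l q_vec * Var Q_vec ^ ?l Q_vec * Var eu_vec ^ ?l eu_vec"
        using monom_subst_superset[OF _ sub, of Var] by (simp add: monom_eq_prod monom_subst_def mult.assoc)
      ultimately show "monom m \<in> sym_alg.span (sharp_vecs d)" by simp
    qed
  qed
qed

lemma ker_vec_Ker:
  assumes "1 \<le> i" "i \<le> j" "j \<le> d - 1"
  shows "ker_vec i j \<in> Ker_eps d"
proof -
  have "Var (a_vec k) * Var (a_vec l) \<in> Sym (Ed_basis d) (Suc 0 + Suc 0)" if "k \<le> d" "l \<le> d" for k l
    by (intro Sym_mult Var_Sym) (use that in \<open>auto simp: Ed_basis_def\<close>)
  then have "ker_vec i j \<in> Sym (Ed_basis d) (Suc 0 + Suc 0)"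
    unfolding ker_vec_def using assms by (intro Sym_diff) auto
  moreover have "ident d (ker_vec i j) = 0"
  proof -
    have e: "d - (i - 1) + (d - (j + 1)) = d - i + (d - j)" "i - 1 + (j + 1) = i + j"
      using assms by auto
    have "ident d (ker_vec i j) = Var t_vec ^ (d - (i - 1) + (d - (j + 1))) * Var u_vec ^ (i - 1 + (j + 1))
        - Var t_vec ^ (d - i + (d - j)) * Var u_vec ^ (i + j)"
      unfolding power_add by (simp add: ker_vec_def lin_diff[OF lin_ident] ident_mult mult_ac)
    then show ?thesis unfolding e by simp
  qed
  ultimately show ?thesis by (simp add: Ker_eps_def numeral_2_eq_2)
qed

section \<open>The kernel of evaluation as a span\<close>

lemma subspace_Ker: "sym_alg.subspace (Ker_eps d)"
proof -
  have "Ker_eps d = Sym (Ed_basis d) 2 \<inter> {p. ident d p \<in> {0}}"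
    by (auto simp: Ker_eps_def)
  then show ?thesis
    using sym_alg.subspace_inter[OF subspace_Sym[of "Ed_basis d" 2]
      subspace_vimage_lin[OF lin_ident[of d] sym_alg.subspace_single_0]] by (simp only:)
qed

text \<open>Modulo the span of the \<open>ker_vec i j\<close>, the product \<open>a\<^sub>k \<star> a\<^sub>l\<close> depends only on \<open>k + l\<close>, that is, on
  its image under \<open>\<epsilon>\<close>.\<close>

lemma Ker_eq_span: "Ker_eps d = sym_alg.span (ker_vecs d)"
proof
  show "sym_alg.span (ker_vecs d) \<subseteq> Ker_eps d"
    by (rule sym_alg.span_minimal[OF _ subspace_Ker]) (auto simp: ker_vecs_def intro: ker_vec_Ker)
  \<comment> \<open>Normal form: \<open>e s\<close> is the most balanced product of index sum
    \<open>s\<close>, and \<open>\<kappa>\<close> recovers it from an image under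
    \<open>ident d\<close> through the exponent of u.\<close>
  define e where "e s = Var (a_vec (s div 2)) * Var (a_vec (s - s div 2))" for s
  define \<kappa> where "\<kappa> = extend (\<lambda>m. e (Poly_Mapping.lookup m u_vec))"
  have lin: "lin \<kappa>" by (simp add: \<kappa>_def lin_extend)
  have balanced: "Var (a_vec k) * Var (a_vec l) - e (k + l) \<in> sym_alg.span (ker_vecs d)"
    if "k \<le> l" "l \<le> d" for k l
    using that
  proof (induction "l - k" arbitrary: k l rule: less_induct)
    case less
    show ?case
    proof (cases "l \<le> Suc k")
      case True
      then have "l = k \<or> l = Suc k" using less.prems by auto
      then have "(k + l) div 2 = k" "k + l - (k + l) div 2 = l" by auto
      then show ?thesis by (simp add: e_def sym_alg.span_zero)
    next
      case False
      \<comment> \<open>Moving both indices one step inward changes the product by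
        \<open>ker_vec (Suc k) (l - 1)\<close>.\<close>
      have "Var (a_vec (Suc k)) * Var (a_vec (l - 1)) - e (Suc k + (l - 1)) \<in> sym_alg.span (ker_vecs d)"
        by (rule less.hyps) (use False less.prems in auto)
      moreover have "ker_vec (Suc k) (l - 1) \<in> ker_vecs d"
        unfolding ker_vecs_def
        by (rule CollectI, rule exI[of _ "Suc k"], rule exI[of _ "l - 1"]) (use False less.prems in auto)
      ultimately have "Var (a_vec (Suc k)) * Var (a_vec (l - 1)) - e (Suc k + (l - 1)) + ker_vec (Suc k) (l - 1)
          \<in> sym_alg.span (ker_vecs d)"
        by (rule sym_alg.span_add[OF _ sym_alg.span_base])
      moreover have "Suc k + (l - 1) = k + l" "l - 1 + 1 = l" using False by auto
      ultimately show ?thesis by (simp add: ker_vec_def)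
    qed
  qed
  have "p - \<kappa> (ident d p) \<in> sym_alg.span (ker_vecs d)" if "p \<in> Sym (Ed_basis d) 2" for p
  proof -
    have "lin (\<lambda>p. p - \<kappa> (ident d p))"
      by (simp add: lin_iff lin_add[OF lin_ident] lin_smult[OF lin_ident] lin_add[OF lin]
          lin_smult[OF lin] sym_alg.scale_right_diff_distrib)
    then show ?thesis
    proof (rule lin_image_span[OF _ sym_alg.subspace_span _ that[unfolded Sym_eq_span]])
      fix b :: "E_basis sym_alg" assume "b \<in> monom ` exps (Ed_basis d) 2"
      then obtain m where "m \<in> exps (Ed_basis d) 2" "b = monom m" by auto
      then obtain x y where xy: "x \<in> Ed_basis d" "y \<in> Ed_basis d" "b = Var x * Var y"
        using exps_2E by metis
      then obtain k l where kl: "k \<le> d" "l \<le> d" "b = Var (a_vec k) * Var (a_vec l)"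
        by (auto simp: Ed_basis_def)
      have "ident d b = monom (Poly_Mapping.single t_vec (d - k) + Poly_Mapping.single u_vec k
          + (Poly_Mapping.single t_vec (d - l) + Poly_Mapping.single u_vec l))"
        unfolding kl(3) ident_mult ident_Var ident_basis_a by (simp only: monom_add)
      then have "\<kappa> (ident d b) = e (k + l)"
        by (simp only: \<kappa>_def extend_monom) (simp add: lookup_add lookup_single)
      then show "b - \<kappa> (ident d b) \<in> sym_alg.span (ker_vecs d)"
        using balanced[of k l] balanced[of l k] kl
        by (cases "k \<le> l") (simp_all add: mult.commute add.commute)
    qed
  qed
  \<comment> \<open>On the kernel the normal form is \<open>\<kappa>\<close> of 0, so
    \<open>p\<close> itself lies in the span.\<close>
  then show "Ker_eps d \<subseteq> sym_alg.span (ker_vecs d)"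
    using sym_alg_pair.linear_0[OF lin] by (force simp: Ker_eps_def)
qed

section \<open>Linear maps read off from the monomials of a polarization\<close>

definition read_off :: "(nat \<Rightarrow> nat \<Rightarrow> nat \<Rightarrow> nat \<Rightarrow> E_basis sym_alg) \<Rightarrow> pair_alg \<Rightarrow> E_basis sym_alg" where
  "read_off H = extend (\<lambda>m. H (Poly_Mapping.lookup m (True, t_vec)) (Poly_Mapping.lookup m (True, u_vec))
     (Poly_Mapping.lookup m (False, t_vec)) (Poly_Mapping.lookup m (False, u_vec)))"

lemma lin_read_off: "lin (read_off H)"
  by (simp add: read_off_def lin_extend)

lemma read_off_monom:
  "read_off H (Var (True, t_vec) ^ p * Var (True, u_vec) ^ q * Var (False, t_vec) ^ r * Var (False, u_vec) ^ s)
   = H p q r s"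
proof -
  have "Var (True, t_vec) ^ p * Var (True, u_vec) ^ q * Var (False, t_vec) ^ r * Var (False, u_vec) ^ s
      = monom (Poly_Mapping.single (True, t_vec) p + Poly_Mapping.single (True, u_vec) q
         + Poly_Mapping.single (False, t_vec) r + Poly_Mapping.single (False, u_vec) s)"
    by (simp only: Var_power monom_add)
  then show ?thesis
    by (simp only: read_off_def extend_monom) (simp add: lookup_add lookup_single)
qed

text \<open>In the terms with both factors in one copy, the first copy has degree 2d or 0, never d,
  so \<open>H\<close> kills them and only the two cross terms survive.\<close>

lemma read_off_polar:
  assumes H: "\<And>p q r s. p + q \<noteq> d \<Longrightarrow> H p q r s = 0" and kl: "k \<le> d" "l \<le> d" and d: "d > 0"
  shows "read_off H (polar d (Var (a_vec k) * Var (a_vec l))) = H (d - k) k (d - l) l + H (d - l) l (d - k) k"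
proof -
  let ?M = "\<lambda>p q r s. Var (True, t_vec) ^ p * Var (True, u_vec) ^ q * Var (False, t_vec) ^ r * Var (False, u_vec) ^ s"
  have "polar d (Var (a_vec k) * Var (a_vec l))
     = ?M (d - k + (d - l)) (k + l) 0 0 + ?M 0 0 (d - k + (d - l)) (k + l)
       + ?M (d - k) k (d - l) l + ?M (d - l) l (d - k) k"
    by (simp add: polar_def subst_mult power_add algebra_simps)
  then have "read_off H (polar d (Var (a_vec k) * Var (a_vec l)))
     = H (d - k + (d - l)) (k + l) 0 0 + H 0 0 (d - k + (d - l)) (k + l)
       + H (d - k) k (d - l) l + H (d - l) l (d - k) k"
    by (simp only: lin_add[OF lin_read_off] read_off_monom)
  moreover have "H (d - k + (d - l)) (k + l) 0 0 = 0" "H 0 0 (d - k + (d - l)) (k + l) = 0"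
    using kl d by (auto intro!: H)
  ultimately show ?thesis by simp
qed

text \<open>Both cross terms of a product return that same product under \<open>H\<close>, so
  reading off inverts \<open>polar d\<close> up to the factor 2.\<close>

lemma polar_eq_0:
  assumes "p \<in> Sym (Ed_basis d) 2" "polar d p = 0" "d > 0"
  shows "p = 0"
proof -
  define H where "H p q r s = (if p + q = d \<and> r + s = d then Var (a_vec q) * Var (a_vec s) else 0)"
    for p q r s
  have "read_off H (polar d p) = smult 2 p"
  proof (rule lin_eq_on_Sym[OF lin_compose[OF lin_polar lin_read_off] _ _ assms(1)])
    show "lin (smult 2 :: E_basis sym_alg \<Rightarrow> _)"
      by (simp add: lin_iff sym_alg.scale_right_distrib sym_alg.scale_left_commute)
    fix m :: "E_basis \<Rightarrow>\<^sub>0 nat" assume "m \<in> exps (Ed_basis d) 2"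
    then obtain x y where xy: "x \<in> Ed_basis d" "y \<in> Ed_basis d" "monom m = Var x * Var y"
      by (rule exps_2E)
    then obtain k l where kl: "k \<le> d" "l \<le> d" "monom m = Var (a_vec k) * Var (a_vec l)"
      by (auto simp: Ed_basis_def)
    have two: "smult 2 v = v + v" for v :: "E_basis sym_alg"
      using sym_alg.scale_left_distrib[of 1 1 v] by simp
    show "read_off H (polar d (monom m)) = smult 2 (monom m)"
      unfolding kl(3) two
      by (subst read_off_polar) (use kl \<open>d > 0\<close> in \<open>auto simp: H_def mult.commute\<close>)
  qed
  then show ?thesis using assms(2) sym_alg_pair.linear_0[OF lin_read_off, of H] by simp
qed

text \<open>The value of \<open>\<rho>\<close> on \<open>a\<^sub>k \<star> a\<^sub>l\<close>, \<open>k \<le> l\<close>, for the extension of \<open>\<rho>\<close> to \<open>Sym\<^sup>2(E\<^sub>d)\<close> that vanishes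
  on the products with \<open>l \<le> k + 1\<close>.\<close>

function tower :: "nat \<Rightarrow> nat \<Rightarrow> nat \<Rightarrow> E_basis sym_alg" where
  "tower d k l = (if k + 2 \<le> l then sharp_vec d (k + 1) (l - 1) + tower d (k + 1) (l - 1) else 0)"
  by auto
termination by (relation "Wellfounded.measure (\<lambda>(d, k, l). l - k)") auto

declare tower.simps [simp del]

lemma tower_Sym: "l \<le> d \<Longrightarrow> tower d k l \<in> Sym Esharp_basis (d - 2)"
proof (induction d k l rule: tower.induct)
  case (1 d k l)
  then show ?case
    by (subst tower.simps) (auto intro!: Sym_add sharp_vec_Sym simp: sym_alg.subspace_0[OF subspace_Sym])
qed

text \<open>The condition \<open>q < s\<close> keeps exactly one of the two cross terms when the
  indices differ; when they agree both are dropped, matching \<open>tower d l l = 0\<close>.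
  Linearity is built in, as values are given on monomials.\<close>

definition rho0 :: "nat \<Rightarrow> E_basis sym_alg \<Rightarrow> E_basis sym_alg" where
  "rho0 d p = read_off (\<lambda>p q r s. if p + q = d \<and> r + s = d \<and> q < s then tower d q s else 0) (polar d p)"

lemma lin_rho0: "lin (rho0 d)"
  unfolding rho0_def by (rule lin_compose[OF lin_polar lin_read_off])

lemma rho0_Sym: "rho0 d p \<in> Sym Esharp_basis (d - 2)"
  unfolding rho0_def read_off_def extend_def
  by (rule sym_alg.subspace_sum[OF subspace_Sym], rule Sym_smult)
     (auto intro: tower_Sym simp: sym_alg.subspace_0[OF subspace_Sym])

lemma rho0_prod:
  assumes "k \<le> l" "l \<le> d" "d > 0"
  shows "rho0 d (Var (a_vec k) * Var (a_vec l)) = tower d k l"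
  unfolding rho0_def
  by (subst read_off_polar) (use assms in \<open>auto simp: tower.simps[of d l l]\<close>)

text \<open>Telescoping: the towers of the two products differ by the single layer
  \<open>sharp_vec d i j\<close>.\<close>

lemma rho0_ker_vec:
  assumes "1 \<le> i" "i \<le> j" "j \<le> d - 1"
  shows "rho0 d (ker_vec i j) = sharp_vec d i j"
proof -
  obtain i' where "i = Suc i'" using assms(1) by (cases i) auto
  then show ?thesis
    using assms by (simp add: ker_vec_def lin_diff[OF lin_rho0] rho0_prod tower.simps[of d i' "Suc j"])
qed

section \<open>Existence and uniqueness of the prescribed map\<close>

lemma is_rho_iff:
  "is_rho d \<rho> \<longleftrightarrow> \<rho> \<in> Ker_eps d \<rightarrow>\<^sub>E Sym Esharp_basis (d - 2) \<and> linear_on (Ker_eps d) \<rho> \<and>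
     (\<forall>i j. 1 \<le> i \<and> i \<le> j \<and> j \<le> d - 1 \<longrightarrow> \<rho> (ker_vec i j) = sharp_vec d i j)"
  by (simp add: is_rho_def ker_vec_def sharp_vec_def)

lemma is_rho_restrict_rho0: "is_rho d (restrict (rho0 d) (Ker_eps d))"
  unfolding is_rho_iff
  by (auto simp: linear_on_def ker_vec_Ker rho0_ker_vec rho0_Sym lin_add[OF lin_rho0] lin_smult[OF lin_rho0]
      sym_alg.subspace_add[OF subspace_Ker] sym_alg.subspace_scale[OF subspace_Ker])

lemma is_rho_eq_rho0:
  assumes "is_rho d \<rho>"
  shows "\<rho> = restrict (rho0 d) (Ker_eps d)"
proof (rule extensionalityI)
  show "\<rho> \<in> extensional (Ker_eps d)" "restrict (rho0 d) (Ker_eps d) \<in> extensional (Ker_eps d)"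
    using assms by (auto simp: is_rho_iff PiE_def)
  have lin: "linear_on (Ker_eps d) \<rho>" and
    B: "\<And>i j. 1 \<le> i \<Longrightarrow> i \<le> j \<Longrightarrow> j \<le> d - 1 \<Longrightarrow> \<rho> (ker_vec i j) = sharp_vec d i j"
    using assms by (auto simp: is_rho_iff)
  \<comment> \<open>Membership in the kernel is carried through the induction because
    \<open>\<rho>\<close> is linear only there.\<close>
  have "w \<in> Ker_eps d \<and> \<rho> w = rho0 d w" if "w \<in> sym_alg.span (ker_vecs d)" for w
    using that
  proof (induction rule: sym_alg.span_induct_alt)
    case base
    have "\<rho> (smult 0 0) = smult 0 (\<rho> 0)"
      using lin sym_alg.subspace_0[OF subspace_Ker] unfolding linear_on_def by blast
    then show ?case
      using sym_alg.subspace_0[OF subspace_Ker] sym_alg_pair.linear_0[OF lin_rho0] by simp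
  next
    case (step c b w)
    then obtain i j where ij: "b = ker_vec i j" "1 \<le> i" "i \<le> j" "j \<le> d - 1"
      by (auto simp: ker_vecs_def)
    then have b: "b \<in> Ker_eps d" "\<rho> b = rho0 d b"
      by (simp_all add: ker_vec_Ker rho0_ker_vec B)
    have cb: "smult c b \<in> Ker_eps d"
      using b(1) by (rule sym_alg.subspace_scale[OF subspace_Ker])
    have "\<rho> (smult c b + w) = smult c (\<rho> b) + \<rho> w"
      using lin b(1) cb step by (simp add: linear_on_def)
    then show ?case
      using step b cb by (simp add: lin_add[OF lin_rho0] lin_smult[OF lin_rho0]
          sym_alg.subspace_add[OF subspace_Ker])
  qed
  then show "\<rho> w = restrict (rho0 d) (Ker_eps d) w" if "w \<in> Ker_eps d" for w
    using that by (simp add: Ker_eq_span[symmetric])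
qed

lemma polar_rho0:
  assumes "w \<in> Ker_eps d"
  shows "polar d w = Delta ^ 2 * polar d (rho0 d w)"
proof (rule lin_eq_on_span[OF lin_polar lin_compose[OF lin_compose[OF lin_rho0 lin_polar] lin_mult_left]])
  show "w \<in> sym_alg.span (ker_vecs d)" using assms by (simp add: Ker_eq_span)
qed (auto simp: ker_vecs_def rho0_ker_vec polar_ker_vec)

section \<open>Bijectivity and equivariance\<close>

lemma bij_betw_rho0:
  assumes "d \<ge> 2"
  shows "bij_betw (rho0 d) (Ker_eps d) (Sym Esharp_basis (d - 2))"
proof (rule bij_betw_imageI)
  show "inj_on (rho0 d) (Ker_eps d)"
  proof (rule inj_onI)
    fix v w assume vw: "v \<in> Ker_eps d" "w \<in> Ker_eps d" "rho0 d v = rho0 d w"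
    then have mem: "v - w \<in> Ker_eps d" by (intro sym_alg.subspace_diff[OF subspace_Ker])
    then have "polar d (v - w) = 0"
      using polar_rho0[OF vw(1)] polar_rho0[OF vw(2)] vw(3) by (simp add: lin_diff[OF lin_polar])
    then show "v = w"
      using polar_eq_0[of "v - w" d] mem assms by (simp add: Ker_eps_def)
  qed
  have "sharp_vecs d \<subseteq> rho0 d ` Ker_eps d"
    unfolding sharp_vecs_def using rho0_ker_vec ker_vec_Ker by (fastforce intro: rev_image_eqI)
  then have "sym_alg.span (sharp_vecs d) \<subseteq> rho0 d ` Ker_eps d"
    by (intro sym_alg.span_minimal sym_alg_pair.linear_subspace_image lin_rho0 subspace_Ker)
  then show "rho0 d ` Ker_eps d = Sym Esharp_basis (d - 2)"
    using Sym_Esharp_subset_span[OF assms] rho0_Sym by blast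
qed

text \<open>Cancels \<open>Delta\<^sup>2\<close> and \<open>polar\<close> in one step: the injectivity of \<open>polar\<close> on the kernel is transported to
  \<open>Sym(E\<^sup>\<sharp>)\<close> through the surjectivity of \<open>rho0\<close>.\<close>

lemma Delta_polar_inject:
  assumes "d \<ge> 2" "v \<in> Sym Esharp_basis (d - 2)" "w \<in> Sym Esharp_basis (d - 2)"
    "Delta ^ 2 * polar d v = Delta ^ 2 * polar d w"
  shows "v = w"
proof -
  obtain x where x: "x \<in> Ker_eps d" "rho0 d x = v - w"
    using bij_betw_imp_surj_on[OF bij_betw_rho0[OF assms(1)]] Sym_diff[OF assms(2,3)] by (metis imageE)
  then have "polar d x = 0"
    using assms(4) by (simp add: polar_rho0 lin_diff[OF lin_polar] right_diff_distrib)
  then have "x = 0" using polar_eq_0[of x d] x(1) assms(1) by (simp add: Ker_eps_def)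
  then show ?thesis using x(2) sym_alg_pair.linear_0[OF lin_rho0] by simp
qed

lemma act_Ker:
  assumes "w \<in> Ker_eps d"
  shows "act d g w \<in> Ker_eps d"
proof -
  have s: "summand d (Ed_basis d) d" by (simp add: summand_def)
  have w: "w \<in> Sym (Ed_basis d) 2" "ident d w = 0" using assms by (auto simp: Ker_eps_def)
  then show ?thesis
    using act_Sym[OF s w(1)] ident_act[OF s w(1)] sym_alg_pair.linear_0[OF lin_act_SymV2]
    by (simp add: Ker_eps_def)
qed

text \<open>After polarizing and multiplying by \<open>Delta ^ 2\<close>, both sides become
  \<open>pair_act g (polar d w)\<close>, and this operation can be cancelled.\<close>

lemma rho0_act:
  assumes "d \<ge> 2" "g \<in> SL2" "w \<in> Ker_eps d"
  shows "rho0 d (act d g w) = act d g (rho0 d w)"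
proof (rule Delta_polar_inject[OF assms(1) rho0_Sym])
  have s: "summand d Esharp_basis 2" "summand d (Ed_basis d) d" by (simp_all add: summand_def)
  have w: "w \<in> Sym (Ed_basis d) 2" using assms(3) by (simp add: Ker_eps_def)
  show "act d g (rho0 d w) \<in> Sym Esharp_basis (d - 2)"
    by (rule act_Sym[OF s(1) rho0_Sym])
  have mult: "pair_act g (p * q) = pair_act g p * pair_act g q" for p q
    by (simp add: pair_act_def subst_mult)
  have "Delta ^ 2 * polar d (rho0 d (act d g w)) = pair_act g (polar d w)"
    using polar_rho0[OF act_Ker[OF assms(3)]] polar_act[OF s(2) w] by simp
  also have "\<dots> = Delta ^ 2 * pair_act g (polar d (rho0 d w))"
    unfolding polar_rho0[OF assms(3)] power2_eq_square mult pair_act_Delta[OF assms(2)] ..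
  also have "pair_act g (polar d (rho0 d w)) = polar d (act d g (rho0 d w))"
    by (rule polar_act[OF s(1) rho0_Sym, symmetric])
  finally show "Delta ^ 2 * polar d (rho0 d (act d g w)) = Delta ^ 2 * polar d (act d g (rho0 d w))" .
qed

theorem lemma3p5:
  fixes d :: nat
  assumes "d \<ge> 2"
  shows "(\<exists>!\<rho>. is_rho d \<rho>) \<and>
         (\<forall>\<rho>. is_rho d \<rho> \<longrightarrow> sl2_module_iso (act d) (Ker_eps d) (Sym Esharp_basis (d - 2)) \<rho>)"
proof -
  let ?\<rho> = "restrict (rho0 d) (Ker_eps d)"
  have s: "summand d Esharp_basis 2" "summand d (Ed_basis d) d" by (simp_all add: summand_def)
  have "Ker_eps d \<subseteq> Sym (Ed_basis d) 2" by (auto simp: Ker_eps_def)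
  then have "sl2_module (act d) (Ker_eps d)"
    by (rule sl2_moduleI[OF s(2) subspace_Ker]) (rule act_Ker)
  moreover have "sl2_module (act d) (Sym Esharp_basis (d - 2))"
    by (rule sl2_moduleI[OF s(1) subspace_Sym order_refl]) (rule act_Sym[OF s(1)])
  moreover have "bij_betw ?\<rho> (Ker_eps d) (Sym Esharp_basis (d - 2))"
    using bij_betw_rho0[OF assms] by simp
  ultimately have "sl2_module_iso (act d) (Ker_eps d) (Sym Esharp_basis (d - 2)) ?\<rho>"
    using is_rho_restrict_rho0[of d] by (auto simp: sl2_module_iso_def is_rho_def act_Ker rho0_act[OF assms])
  \<comment> \<open>Every map satisfying \<open>is_rho\<close> equals the restricted
    \<open>rho0\<close>, so the isomorphism property passes to it.\<close>
  then show ?thesis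
    using is_rho_restrict_rho0 is_rho_eq_rho0 by (metis (lifting))
qed

end
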